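(* The following hold. (a) If $\phi\in\mathcal{LP}_1$ is not identically zero and has order $\rho<1$, then $\phi(D)$ is not a CZSDO. (b) If $\phi\in\mathcal{LP}_1$ has order $\rho=1$ and is of minimal type, then $\phi(D)$ is not a CZSDO. (c) If $\phi(z)=e^{\alpha z}$ where $\alpha\in\mathbb{R}$ and $f\in\mathcal{LP}(r)$ with $r\ge 0$, then $\phi(D)f(z)=f(z+\alpha)$. Hence $\phi(D)$ is not a CZSDO. Therefore, the following is a necessary condition, for $\phi\in\mathcal{LP}_1$ not identically zero, for $\phi(D)$ to be a CZSDO: if the Weierstrass canonical product of $\phi$ is $$\phi(z)=c z^m e^{\alpha z}\prod_n\Big(1-\frac{z}{a_n}\Big)e^{z/a_n}$$ (with $c,\alpha$ real, $c\neq 0$, $m$ a nonnegative integer, $(a_n)$ a finite or infinite, possibly empty, sequence of nonzero reals with $\sum_n a_n^{-2}<\infty$), then the product $$c z^m\prod_n\Big(1-\frac{z}{a_n}\Big)e^{z/a_n},$$ with the factor $e^{\alpha z}$ omitted, has order $\rho=1$ and type $\sigma>0$ or has order $\rho>1$.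
   Context: A real entire function is an entire function taking real values on the real line. For $r\ge 0$ let $S(r)=\{z\in\mathbb{C}: -r\le \operatorname{Im} z\le r\}$, and let $\mathcal{LP}(r)$ be the class of real entire functions with a product representation $$c z^m e^{a z-b z^2}\prod_k\Big(1-\frac{z}{\alpha_k}\Big)e^{z/\alpha_k},$$ where $c,a,b$ are real, $b\ge 0$, $m$ is a nonnegative integer, $(\alpha_k)$ is a finite (possibly empty) or infinite sequence of nonzero complex numbers in $S(r)$, and $\sum_k|\alpha_k|^{-2}<\infty$ (since the function is real, nonreal zeros occur in complex conjugate pairs; $c=0$ is allowed, so the zero function belongs to the class). $\mathcal{LP}_1(r)$ is the subclass with $b=0$. Put $\mathcal{LP}=\mathcal{LP}(0)$ (the Laguerre-Pólya class) and $\mathcal{LP}_1=\mathcal{LP}_1(0)$. For $\phi(z)=\sum_{k\ge 0}a_kz^k\in\mathcal{LP}_1$ and $f\in\mathcal{LP}(r)$ with $r\ge0$, define $\phi(D)f(z)=\sum_{k\ge 0}a_k f^{(k)}(z)$, where $D$ is differentiation; it is a known fact (Levin) that this series converges uniformly on compact subsets of $\mathbb{C}$ and that $\phi(D)f\in\mathcal{LP}(r)$. For $\phi\in\mathcal{LP}_1$, the operator $\phi(D)$ is called a complex zero strip decreasing operator (CZSDO) if for each $r>0$ there exists $r_1$ with $0\le r_1<r$ such that $\phi(D)f\in\mathcal{LP}(r_1)$ for all $f\in\mathcal{LP}(r)$. For an entire function $\phi$ put $M_\phi(r)=\max_{|z|=r}|\phi(z)|$. The order $\rho$ of $\phi$ is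 the infimum of the $k>0$ such that $M_\phi(r)<e^{r^k}$ for all sufficiently large $r$. If $0<\rho<\infty$, the type $\sigma\in[0,\infty]$ of $\phi$ is the infimum of the $\epsilon>0$ such that $M_\phi(r)<e^{\epsilon r^\rho}$ for all sufficiently large $r$ ($\sigma=\infty$ if there is no such $\epsilon$). $\phi$ is of minimal type if $\sigma=0$. *)

theory Defs
  imports "HOL-Complex_Analysis.Complex_Analysis" "HOL-Library.Extended_Nat"
begin

definition real_entire :: "(complex \<Rightarrow> complex) \<Rightarrow> bool" where
  "real_entire f \<longleftrightarrow> f holomorphic_on UNIV \<and> (\<forall>x::real. f (of_real x) \<in> \<real>)"

definition strip :: "real \<Rightarrow> complex set" where
  "strip r = {z. - r \<le> Im z \<and> Im z \<le> r}"

(* A finite or infinite sequence is a function on nat together with its length N :: enat;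
   its terms are those with enat k < N, and values beyond the length are irrelevant. *)

definition genus1_zeros :: "enat \<Rightarrow> (nat \<Rightarrow> complex) \<Rightarrow> bool" where
  "genus1_zeros N \<alpha> \<longleftrightarrow>
     (\<forall>k. enat k < N \<longrightarrow> \<alpha> k \<noteq> 0) \<and>
     (\<lambda>k. 1 / (norm (\<alpha> k))\<^sup>2) summable_on {k. enat k < N}"

definition canonical_product :: "enat \<Rightarrow> (nat \<Rightarrow> complex) \<Rightarrow> complex \<Rightarrow> complex" where
  "canonical_product N \<alpha> z =
     (\<Prod>k. if enat k < N then (1 - z / \<alpha> k) * exp (z / \<alpha> k) else 1)"

definition LP_rep :: "real \<Rightarrow> real \<Rightarrow> (complex \<Rightarrow> complex) \<Rightarrow> bool" where
  "LP_rep r b f \<longleftrightarrow>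
     (\<exists>(c::real) (a::real) (m::nat) N \<alpha>.
        genus1_zeros N \<alpha> \<and> (\<forall>k. enat k < N \<longrightarrow> \<alpha> k \<in> strip r) \<and>
        (\<forall>z. f z = of_real c * z ^ m * exp (of_real a * z - of_real b * z\<^sup>2)
                     * canonical_product N \<alpha> z))"

definition LP :: "real \<Rightarrow> (complex \<Rightarrow> complex) set" where
  "LP r = {f. real_entire f \<and> (\<exists>b\<ge>0. LP_rep r b f)}"

definition LP1 :: "real \<Rightarrow> (complex \<Rightarrow> complex) set" where
  "LP1 r = {f. real_entire f \<and> LP_rep r 0 f}"

(* phi(D) f, where a_k = phi^(k)(0) / k! are the Taylor coefficients of phi at 0 *)

definition diff_op :: "(complex \<Rightarrow> complex) \<Rightarrow> (complex \<Rightarrow> complex) \<Rightarrow> complex \<Rightarrow> complex" where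
  "diff_op \<phi> f z = (\<Sum>k. (deriv ^^ k) \<phi> 0 / fact k * (deriv ^^ k) f z)"

(* Only meaningful for phi in LP1 0. *)

definition CZSDO :: "(complex \<Rightarrow> complex) \<Rightarrow> bool" where
  "CZSDO \<phi> \<longleftrightarrow>
     (\<forall>r>0. \<exists>r1. 0 \<le> r1 \<and> r1 < r \<and> (\<forall>f \<in> LP r. diff_op \<phi> f \<in> LP r1))"

(* For r >= 0 and continuous f the supremum is attained. *)

definition max_modulus :: "(complex \<Rightarrow> complex) \<Rightarrow> real \<Rightarrow> real" where
  "max_modulus f r = (SUP z\<in>sphere 0 r. norm (f z))"

(* Infima are taken in the extended reals, so that the infimum of the empty set is \<infinity>. *)

definition growth_order :: "(complex \<Rightarrow> complex) \<Rightarrow> ereal" where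
  "growth_order f =
     Inf {ereal k | k. k > 0 \<and> (\<forall>\<^sub>F r in at_top. max_modulus f r < exp (r powr k))}"

(* Only meaningful when 0 < growth_order f < \<infinity>. *)

definition growth_type :: "(complex \<Rightarrow> complex) \<Rightarrow> ereal" where
  "growth_type f =
     Inf {ereal \<epsilon> | \<epsilon>. \<epsilon> > 0 \<and>
       (\<forall>\<^sub>F r in at_top. max_modulus f r < exp (\<epsilon> * r powr real_of_ereal (growth_order f)))}"

end

theory Submission
  imports
    Defs
    "HOL-Computational_Algebra.Fundamental_Theorem_Algebra"
    "HOL-Real_Asymp.Real_Asymp"
begin

text \<open>
  The idea is to test $\phi(D)$ on $f(z) = \sin(\lambda z)(\cos(\lambda z) - \cosh(\lambda r))$, which lies in
  $\mathcal{LP}(r)$ and has frequencies $\pm\lambda$ and $\pm 2\lambda$ only. With $x = e^{i\lambda z}$,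
  $x^2\,\phi(D)f(z)$ is a polynomial of degree 4 in $x$. If $\phi(D)f \in \mathcal{LP}(r_1)$, all its roots
  satisfy $|x| \le e^{\lambda r_1}$, so their sum, read off the two leading coefficients, gives
  $\cosh(\lambda r)\,|\phi(i\lambda)| \le 2 e^{\lambda r_1}\,|\phi(2i\lambda)|$. Since the zeros of $\phi$ are real,
  $|\phi(i\lambda)|$ is bounded below for $\lambda \ge 1$; hence $|\phi(2i\lambda)|$ grows at least like
  $e^{(r - r_1)\lambda}$. A factor $e^{\alpha z}$ with real $\alpha$ has modulus 1 on the imaginary axis and
  plays no role. As the frequency 0 does not occur in $f$, a zero of $\phi$ at the origin is harmless.
\<close>

section \<open>Polynomials: subleading coefficient and size of the roots\<close>

text \<open>By Vieta, the quotient of the subleading by the leading coefficient is minus the sum of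
  the roots with multiplicity, a sum of \<open>degree p\<close> terms of modulus at most
  \<open>R\<close>.\<close>

lemma poly_subleading_coeff_bound:
  fixes p :: "complex poly"
  assumes "degree p > 0" and roots: "\<And>x. poly p x = 0 \<Longrightarrow> norm x \<le> R"
  shows "norm (coeff p (degree p - 1)) \<le> real (degree p) * R * norm (lead_coeff p)"
proof -
  \<comment> \<open>Induction over the multiset of roots. For \<open>A = {#}\<close> natural
    subtraction gives \<open>size A - 1 = 0\<close>, so the coefficient would be the leading one, 1,
    against a bound of 0; hence the guard.\<close>
  have monic: "degree Q = size A \<and> lead_coeff Q = 1 \<and>
      (A \<noteq> {#} \<longrightarrow> norm (coeff Q (size A - 1)) \<le> real (size A) * R)"
    if "\<And>x. x \<in># A \<Longrightarrow> norm x \<le> R" "Q = (\<Prod>x\<in>#A. [:-x, 1:])" for A and Q :: "complex poly"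
    using that
  proof (induction A arbitrary: Q)
    case empty
    then show ?case by simp
  next
    case (add x A)
    define Q0 where "Q0 = (\<Prod>x\<in>#A. [:-x, 1:])"
    have Q: "Q = [:-x, 1:] * Q0"
      using add.prems(2) by (simp add: Q0_def)
    have IH: "degree Q0 = size A" "lead_coeff Q0 = 1"
        "A \<noteq> {#} \<Longrightarrow> norm (coeff Q0 (size A - 1)) \<le> real (size A) * R"
      using add.IH[OF _ Q0_def] add.prems(1) by auto
    have nz: "Q0 \<noteq> 0"
      using IH(2) by auto
    have deg: "degree Q = size (add_mset x A)"
      using nz IH(1) by (simp add: Q degree_mult_eq del: mult_pCons_left)
    have lead: "lead_coeff Q = 1"
      unfolding Q lead_coeff_mult IH(2) by simp
    have x: "norm x \<le> R"
      using add.prems(1) by simp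
    have "norm (coeff Q (size A)) \<le> real (Suc (size A)) * R"
    proof (cases "A = {#}")
      case True
      then show ?thesis
        using x by (simp add: Q Q0_def)
    next
      case False
      then obtain n where n: "size A = Suc n"
        by (cases "size A") auto
      have "coeff Q (size A) = coeff Q0 n - x"
        using IH(1,2) n by (simp add: Q)
      also have "norm \<dots> \<le> real (size A) * R + R"
        using norm_triangle_ineq4[of "coeff Q0 n" x] IH(3)[OF False] x n by simp
      finally show ?thesis
        by (simp add: algebra_simps)
    qed
    then show ?case
      using deg lead by simp
  qed
  have "p \<noteq> 0"
    using assms(1) by auto
  define l where "l = lead_coeff p"
  obtain A where A: "size A = degree p" "p = smult l (\<Prod>x\<in>#A. [:-x, 1:])"
    using alg_closed_imp_factorization[OF \<open>p \<noteq> 0\<close>] unfolding l_def by (elim exE conjE)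
  define Q where "Q = (\<Prod>x\<in>#A. [:-x, 1:])"
  have coeff_p: "coeff p k = l * coeff Q k" and poly_p: "poly p x = l * poly Q x" for k x
    using A(2) by (simp_all add: Q_def)
  have "norm x \<le> R" if "x \<in># A" for x
  proof (rule roots)
    have "poly Q x = 0"
      using that by (auto simp: Q_def poly_prod_mset prod_mset_zero_iff)
    then show "poly p x = 0"
      by (simp add: poly_p)
  qed
  moreover have "A \<noteq> {#}"
    using A(1) assms(1) by auto
  ultimately have "norm (coeff Q (size A - 1)) \<le> real (size A) * R"
    using monic[OF _ Q_def] by blast
  then have "norm l * norm (coeff Q (size A - 1)) \<le> norm l * (real (size A) * R)"
    by (rule mult_left_mono) simp
  then show ?thesis
    using A(1) l_def coeff_p[of "degree p - 1"] by (simp add: norm_mult mult_ac)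
qed

section \<open>Action of the operator on exponential sums, and translations\<close>

lemma higher_deriv_exp_sum:
  fixes c \<mu> :: "'a \<Rightarrow> complex"
  shows "(deriv ^^ k) (\<lambda>z. \<Sum>j\<in>S. c j * exp (\<mu> j * z)) = (\<lambda>z. \<Sum>j\<in>S. c j * \<mu> j ^ k * exp (\<mu> j * z))"
proof (induction k)
  case 0
  then show ?case by simp
next
  case (Suc k)
  have "((\<lambda>z. \<Sum>j\<in>S. c j * \<mu> j ^ k * exp (\<mu> j * z)) has_field_derivative
         (\<Sum>j\<in>S. c j * \<mu> j ^ Suc k * exp (\<mu> j * z))) (at z)" for z
    by (auto intro!: derivative_eq_intros sum.cong)
  then show ?case
    using Suc by (auto simp: DERIV_imp_deriv)
qed

text \<open>A ball of radius |h| + 1 about z contains z + h. Centre 0 serves to evaluate the symbol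
  at a frequency, a general centre to recognise a translate.\<close>

lemma entire_power_series:
  assumes "f holomorphic_on UNIV"
  shows "(\<lambda>k. (deriv ^^ k) f z / fact k * h ^ k) sums f (z + h)"
proof -
  have "z + h \<in> ball z (norm h + 1)"
    by (simp add: dist_norm)
  then show ?thesis
    using holomorphic_power_series[of f z "norm h + 1" "z + h"] assms holomorphic_on_subset
    by auto
qed

text \<open>Each exponential is an eigenfunction of D with eigenvalue \<open>\<mu> j\<close>, so the
  operator series becomes the Taylor series of \<open>\<phi>\<close> at
  \<open>\<mu> j\<close>.\<close>

lemma diff_op_exp_sum:
  fixes c \<mu> :: "'a \<Rightarrow> complex"
  assumes "\<phi> holomorphic_on UNIV"
  shows "diff_op \<phi> (\<lambda>z. \<Sum>j\<in>S. c j * exp (\<mu> j * z)) z = (\<Sum>j\<in>S. c j * \<phi> (\<mu> j) * exp (\<mu> j * z))"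
proof -
  have "(\<lambda>k. (deriv ^^ k) \<phi> 0 / fact k * \<mu> j ^ k) sums \<phi> (\<mu> j)" for j
    using entire_power_series[OF assms, of 0 "\<mu> j"] by simp
  then have "(\<lambda>k. \<Sum>j\<in>S. (c j * exp (\<mu> j * z)) * ((deriv ^^ k) \<phi> 0 / fact k * \<mu> j ^ k))
      sums (\<Sum>j\<in>S. (c j * exp (\<mu> j * z)) * \<phi> (\<mu> j))"
    by (intro sums_sum sums_mult)
  then have "(\<lambda>k. (deriv ^^ k) \<phi> 0 / fact k * (\<Sum>j\<in>S. c j * \<mu> j ^ k * exp (\<mu> j * z)))
      sums (\<Sum>j\<in>S. c j * \<phi> (\<mu> j) * exp (\<mu> j * z))"
    by (simp add: sum_distrib_left sum_distrib_right mult_ac)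
  then show ?thesis
    unfolding diff_op_def higher_deriv_exp_sum by (rule sums_unique[symmetric])
qed

text \<open>The Taylor coefficients of the symbol are a^k / k!, which turns the operator series into
  the Taylor series of f about z with increment a.\<close>

lemma diff_op_exp:
  assumes "f holomorphic_on UNIV"
  shows "diff_op (\<lambda>w. exp (a * w)) f z = f (z + a)"
proof -
  have "(deriv ^^ k) (\<lambda>w. exp (a * w)) 0 = a ^ k" for k
    using higher_deriv_exp_sum[of k "\<lambda>_. 1" "\<lambda>_. a" "{()}"] by simp
  then have "diff_op (\<lambda>w. exp (a * w)) f z = (\<Sum>k. (deriv ^^ k) f z / fact k * a ^ k)"
    by (simp add: diff_op_def mult_ac)
  also have "\<dots> = f (z + a)"
    using entire_power_series[OF assms] by (rule sums_unique[symmetric])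
  finally show ?thesis .
qed

section \<open>Canonical products: convergence, zeros, values on the imaginary axis\<close>

text \<open>With w = z / \<alpha> k the factor is the Weierstrass factor of genus 1, within 3 |w|^2
  of 1 once |w| is at most 1/2. Square summability of the reciprocals then gives absolute
  convergence.\<close>

lemma canonical_product_convergent:
  assumes "genus1_zeros N \<alpha>"
  shows "convergent_prod (\<lambda>k. if enat k < N then (1 - z / \<alpha> k) * exp (z / \<alpha> k) else 1)"
    (is "convergent_prod ?F")
proof -
  define a where "a k = (if enat k < N then 1 / (norm (\<alpha> k))\<^sup>2 else 0)" for k
  have "(\<lambda>k. 1 / (norm (\<alpha> k))\<^sup>2) summable_on {k. enat k < N} \<longleftrightarrow> a summable_on UNIV"
    by (rule summable_on_cong_neutral) (auto simp: a_def)
  then have a: "summable a"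
    using assms summable_on_UNIV_nonneg_real_iff[of a]
    by (auto simp: genus1_zeros_def a_def)
  have "(\<lambda>k. (norm z)\<^sup>2 * a k) \<longlonglongrightarrow> (norm z)\<^sup>2 * 0"
    using summable_LIMSEQ_zero[OF a] by (intro tendsto_intros)
  then have small: "\<forall>\<^sub>F k in sequentially. (norm z)\<^sup>2 * a k < 1 / 4"
    by (rule order_tendstoD(2)) simp
  have "\<forall>\<^sub>F k in sequentially. norm (norm (?F k - 1)) \<le> 3 * (norm z)\<^sup>2 * a k"
    using small
  proof eventually_elim
    case (elim k)
    show ?case
    proof (cases "enat k < N")
      case True
      define w where "w = z / \<alpha> k"
      have w2: "(norm w)\<^sup>2 = (norm z)\<^sup>2 * a k"
        using True by (simp add: w_def a_def norm_divide power_divide)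
      then have "(norm w)\<^sup>2 \<le> (1 / 2)\<^sup>2"
        using elim by (simp add: power2_eq_square)
      then have "norm w \<le> 1 / 2"
        by (rule power2_le_imp_le) simp
      then have "norm (weierstrass_factor 1 w - 1) \<le> 3 * norm w ^ 2"
        using weierstrass_factor_bound[of w 1] by (simp add: power2_eq_square)
      then show ?thesis
        using True w2 by (simp add: weierstrass_factor_def w_def)
    qed (simp add: a_def)
  qed
  then have "summable (\<lambda>k. norm (?F k - 1))"
    using summable_mult[OF a] by (rule summable_comparison_test_ev)
  then show ?thesis
    by (intro abs_convergent_prod_imp_convergent_prod summable_imp_abs_convergent_prod)
qed

lemma canonical_product_LIMSEQ:
  assumes "genus1_zeros N \<alpha>"
  shows "(\<lambda>n. \<Prod>k<n. if enat k < N then (1 - z / \<alpha> k) * exp (z / \<alpha> k) else 1)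
           \<longlonglongrightarrow> canonical_product N \<alpha> z"
proof -
  have "(\<lambda>n. \<Prod>k\<le>n. if enat k < N then (1 - z / \<alpha> k) * exp (z / \<alpha> k) else 1)
           \<longlonglongrightarrow> canonical_product N \<alpha> z"
    unfolding canonical_product_def
    by (rule convergent_prod_LIMSEQ[OF canonical_product_convergent[OF assms]])
  then show ?thesis
    by (subst filterlim_sequentially_Suc[symmetric]) (simp add: lessThan_Suc_atMost)
qed

text \<open>A convergent infinite product vanishes only if some factor does, and neither the
  exponentials nor the padding by 1 can vanish.\<close>

lemma canonical_product_eq_0_imp:
  assumes "genus1_zeros N \<alpha>" "canonical_product N \<alpha> z = 0"
  obtains k where "enat k < N" "z = \<alpha> k"
proof -
  let ?F = "\<lambda>k. if enat k < N then (1 - z / \<alpha> k) * exp (z / \<alpha> k) else 1"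
  have "?F has_prod 0"
    using convergent_prod_has_prod[OF canonical_product_convergent[OF assms(1), of z]] assms(2)
    by (simp add: canonical_product_def)
  then obtain k where "?F k = 0"
    by (auto simp: has_prod_0_iff)
  then have "enat k < N" "z = \<alpha> k"
    using assms(1) by (auto simp: genus1_zeros_def split: if_splits)
  then show thesis by (rule that)
qed

text \<open>For real t, 1 - iy/t has real part 1 and exp(iy/t) has modulus 1, so every factor has
  modulus at least 1, and this passes to the limit.\<close>

lemma norm_canonical_product_imaginary:
  fixes y :: real
  assumes "genus1_zeros N \<alpha>" and real: "\<And>k. enat k < N \<Longrightarrow> \<alpha> k \<in> \<real>"
  shows "norm (canonical_product N \<alpha> (\<i> * y)) \<ge> 1"
proof -
  let ?F = "\<lambda>k. if enat k < N then (1 - (\<i> * y) / \<alpha> k) * exp ((\<i> * y) / \<alpha> k) else 1"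
  have "norm (?F k) \<ge> 1" for k
  proof (cases "enat k < N")
    case True
    then obtain t :: real where t: "\<alpha> k = of_real t"
      using real Reals_cases by blast
    have "\<i> * y / \<alpha> k = \<i> * of_real (y / t)"
      using t by simp
    moreover have "norm (1 - \<i> * of_real (y / t)) \<ge> 1"
      using abs_Re_le_cmod[of "1 - \<i> * of_real (y / t)"] by simp
    ultimately show ?thesis
      using True by (simp only: if_True norm_mult norm_exp_i_times)
  qed simp
  then have "norm (\<Prod>k<n. ?F k) \<ge> 1" for n
    unfolding prod_norm[symmetric] by (intro prod_ge_1) auto
  moreover have "(\<lambda>n. norm (\<Prod>k<n. ?F k)) \<longlonglongrightarrow> norm (canonical_product N \<alpha> (\<i> * y))"
    by (intro tendsto_norm canonical_product_LIMSEQ assms)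
  ultimately show ?thesis
    by (intro LIMSEQ_le_const) auto
qed

text \<open>The point w excludes the zero function, for which c = 0 and every point is a zero. A
  zero at the origin may come from \<open>z ^ m\<close>; any other comes from the product.\<close>

lemma LP_zero_in_strip:
  assumes "f \<in> LP r" "r \<ge> 0" "f z = 0" "f w \<noteq> 0"
  shows "z \<in> strip r"
proof -
  obtain b c a m N \<alpha> where g: "genus1_zeros N \<alpha>" and s: "\<And>k. enat k < N \<Longrightarrow> \<alpha> k \<in> strip r"
    and f: "\<And>z. f z = complex_of_real c * z ^ m * exp (complex_of_real a * z - complex_of_real b * z\<^sup>2)
                     * canonical_product N \<alpha> z"
    using assms(1) unfolding LP_def LP_rep_def by blast
  have "c \<noteq> 0"
    using f[of w] assms(4) by auto
  then consider "z = 0" | "canonical_product N \<alpha> z = 0"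
    using f[of z] assms(3) by (auto split: if_splits)
  then show ?thesis
  proof cases
    case 1
    then show ?thesis using assms(2) by (simp add: strip_def)
  next
    case 2
    then show ?thesis using canonical_product_eq_0_imp[OF g 2] s by metis
  qed
qed

text \<open>The constant is |c|: on the imaginary axis the exponential factor has modulus 1, the
  canonical product has modulus at least 1, and so has \<open>z ^ m\<close> when |y| is at least
  1.\<close>

lemma LP1_imaginary_lower_bound:
  assumes "\<phi> \<in> LP1 0" "\<phi> \<noteq> (\<lambda>_. 0)"
  obtains C where "C > 0" "\<And>y. 1 \<le> \<bar>y\<bar> \<Longrightarrow> C \<le> norm (\<phi> (\<i> * complex_of_real y))"
proof -
  obtain c a m N \<alpha> where g: "genus1_zeros N \<alpha>" and s: "\<And>k. enat k < N \<Longrightarrow> \<alpha> k \<in> strip 0"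
    and f: "\<And>z. \<phi> z = complex_of_real c * z ^ m * exp (complex_of_real a * z - complex_of_real 0 * z\<^sup>2)
                     * canonical_product N \<alpha> z"
    using assms(1) unfolding LP1_def LP_rep_def by blast
  have "c \<noteq> 0"
    using assms(2) f by auto
  have "norm (\<phi> (\<i> * y)) \<ge> \<bar>c\<bar>" if "1 \<le> \<bar>y\<bar>" for y :: real
  proof -
    have "norm (canonical_product N \<alpha> (\<i> * y)) \<ge> 1"
      using s by (intro norm_canonical_product_imaginary g)
        (auto simp: strip_def complex_is_Real_iff intro: antisym)
    moreover have "norm (\<phi> (\<i> * y)) = \<bar>c\<bar> * (\<bar>y\<bar> ^ m * norm (canonical_product N \<alpha> (\<i> * y)))"
      using that by (simp add: f norm_mult norm_power)
    moreover have "\<bar>y\<bar> ^ m \<ge> 1"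
      using that by simp
    ultimately show ?thesis
      using mult_mono[of 1 "\<bar>y\<bar> ^ m" 1 "norm (canonical_product N \<alpha> (\<i> * y))"]
        mult_left_mono[of 1 _ "\<bar>c\<bar>"] by fastforce
  qed
  with \<open>c \<noteq> 0\<close> show thesis
    by (intro that[of "\<bar>c\<bar>"]) auto
qed

section \<open>The test function and its canonical product\<close>

lemma cosh_complex_of_real: "cosh (complex_of_real x) = complex_of_real (cosh x)"
  by (simp add: cosh_field_def flip: exp_of_real of_real_minus)

text \<open>For positive r and l the sine vanishes at the real points pi n / l, and the second
  factor, as cosh(lr) = cos(ilr), at 2 pi n / l + ir and 2 pi n / l - ir on the boundary of the
  strip.\<close>

definition trig_test :: "real \<Rightarrow> real \<Rightarrow> complex \<Rightarrow> complex" where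
  "trig_test r l z = sin (l * z) * (cos (l * z) - complex_of_real (cosh (l * r)))"

text \<open>
  With $t = 2\pi n/\lambda$, the block of indices $2 + 6(n-1), \dots, 2 + 6n - 1$ lists
  $\pm t/2$, $\pm(t - ir)$, $\pm(t + ir)$. Opposite zeros are adjacent so that the exponential convergence
  factors cancel in pairs. The simple zero at the origin is left out.
\<close>
definition trig_test_zero :: "real \<Rightarrow> real \<Rightarrow> nat \<Rightarrow> complex" where
  "trig_test_zero r l k =
     (if k = 0 then \<i> * r else if k = 1 then - (\<i> * r)
      else let t = complex_of_real (2 * pi / l * real ((k - 2) div 6 + 1))
           in [t / 2, - (t / 2), t - \<i> * r, - (t - \<i> * r), t + \<i> * r, - (t + \<i> * r)] ! ((k - 2) mod 6))"

lemma paired_factors: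
  fixes b z :: complex
  shows "(1 - z / b) * exp (z / b) * ((1 - z / (- b)) * exp (z / (- b))) = 1 - z\<^sup>2 / b\<^sup>2"
proof -
  have "(1 - z / b) * exp (z / b) * ((1 - z / (- b)) * exp (z / (- b)))
      = (1 - z / b) * (1 + z / b) * (exp (z / b) * exp (- (z / b)))"
    by (simp add: mult_ac)
  also have "\<dots> = 1 - z\<^sup>2 / b\<^sup>2"
    by (simp add: mult_exp_exp algebra_simps power2_eq_square)
  finally show ?thesis .
qed

lemma trig_test_zero_block:
  assumes "j < 6"
  shows "trig_test_zero r l (2 + 6 * n + j) =
     (let t = complex_of_real (2 * pi / l * real (Suc n))
      in [t / 2, - (t / 2), t - \<i> * r, - (t - \<i> * r), t + \<i> * r, - (t + \<i> * r)] ! j)"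
proof -
  have "(2 + 6 * n + j - 2) div 6 = n" "(2 + 6 * n + j - 2) mod 6 = j"
    using assms by auto
  then show ?thesis
    using assms by (simp add: trig_test_zero_def)
qed

lemma trig_test_zero_cases:
  fixes k :: nat
  obtains "k = 0" | "k = 1" | n j where "j < 6" "k = 2 + 6 * n + j"
proof (cases "k \<ge> 2")
  case True
  then have "k = 2 + 6 * ((k - 2) div 6) + (k - 2) mod 6"
    by simp
  moreover have "(k - 2) mod 6 < 6"
    by simp
  ultimately show ?thesis
    using that(3) by blast
next
  case False
  then show ?thesis
    using that(1,2) by force
qed

text \<open>Partial products ending at a complete block are free of exponentials. Keeping t as a
  parameter leaves the caller free to write it as a multiple of another constant.\<close>

lemma trig_test_partial_product:
  assumes t_def: "\<And>k. t k = complex_of_real (2 * pi / l * real k)"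
  shows "(\<Prod>k<2 + 6 * n. (1 - z / trig_test_zero r l k) * exp (z / trig_test_zero r l k))
    = (1 - z\<^sup>2 / (\<i> * r)\<^sup>2) * (\<Prod>k=1..n. (1 - z\<^sup>2 / (t k / 2)\<^sup>2) * (1 - z\<^sup>2 / (t k - \<i> * r)\<^sup>2) * (1 - z\<^sup>2 / (t k + \<i> * r)\<^sup>2))"
proof (induction n)
  case 0
  have "{..<2 + 6 * (0::nat)} = {0, 1}"
    by auto
  then show ?case
    using paired_factors[of z "\<i> * r"] by (simp add: trig_test_zero_def)
next
  case (Suc n)
  let ?F = "\<lambda>b. (1 - z / b) * exp (z / b)"
  let ?G = "\<lambda>k. ?F (trig_test_zero r l k)"
  define N where "N = 2 + 6 * n"
  have "trig_test_zero r l (N + j) =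
      [t (Suc n) / 2, - (t (Suc n) / 2), t (Suc n) - \<i> * r, - (t (Suc n) - \<i> * r), t (Suc n) + \<i> * r, - (t (Suc n) + \<i> * r)] ! j"
    if "j < 6" for j
    using trig_test_zero_block[OF that, of r l n] by (simp only: N_def t_def Let_def)
  from this[of 0] this[of 1] this[of 2] this[of 3] this[of 4] this[of 5]
  have zeros: "trig_test_zero r l (N + 0) = t (Suc n) / 2"
      "trig_test_zero r l (N + 1) = - (t (Suc n) / 2)"
      "trig_test_zero r l (N + 2) = t (Suc n) - \<i> * r"
      "trig_test_zero r l (N + 3) = - (t (Suc n) - \<i> * r)"
      "trig_test_zero r l (N + 4) = t (Suc n) + \<i> * r"
      "trig_test_zero r l (N + 5) = - (t (Suc n) + \<i> * r)"
    by simp_all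
  have "2 + 6 * Suc n = Suc (Suc (Suc (Suc (Suc (Suc N)))))"
    by (simp add: N_def)
  then have "(\<Prod>k<2 + 6 * Suc n. ?G k) = (\<Prod>k<N. ?G k) *
      (?G (N + 0) * ?G (N + 1) * (?G (N + 2) * ?G (N + 3)) * (?G (N + 4) * ?G (N + 5)))"
    by (simp add: prod.lessThan_Suc mult_ac eval_nat_numeral)
  also have "?G (N + 0) * ?G (N + 1) = 1 - z\<^sup>2 / (t (Suc n) / 2)\<^sup>2"
    by (simp only: zeros paired_factors)
  also have "?G (N + 2) * ?G (N + 3) = 1 - z\<^sup>2 / (t (Suc n) - \<i> * r)\<^sup>2"
    by (simp only: zeros paired_factors)
  also have "?G (N + 4) * ?G (N + 5) = 1 - z\<^sup>2 / (t (Suc n) + \<i> * r)\<^sup>2"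
    by (simp only: zeros paired_factors)
  finally show ?case
    using Suc.IH by (simp add: N_def mult.assoc)
qed

lemma trig_test_zero_properties:
  assumes "r > 0" "l > 0"
  shows "trig_test_zero r l k \<in> strip r" "trig_test_zero r l k \<noteq> 0"
    and "k \<ge> 2 \<Longrightarrow> norm (trig_test_zero r l k) \<ge> pi / l / 12 * real k"
proof -
  let ?a = "trig_test_zero r l k"
  have "?a \<in> strip r \<and> ?a \<noteq> 0 \<and> (k \<ge> 2 \<longrightarrow> norm ?a \<ge> pi / l / 12 * real k)"
  proof (cases rule: trig_test_zero_cases[of k])
    case 1
    then show ?thesis using assms by (simp add: trig_test_zero_def strip_def norm_mult)
  next
    case 2
    then show ?thesis using assms by (simp add: trig_test_zero_def strip_def norm_mult)
  next
    case (3 n j)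
    define u where "u = 2 * pi / l * real (Suc n)"
    have u: "u > 0"
      using assms by (simp add: u_def)
    have a: "?a = [u / 2, - (u / 2), u - \<i> * r, - (u - \<i> * r), u + \<i> * r, - (u + \<i> * r)] ! j"
      unfolding 3(2) trig_test_zero_block[OF 3(1)] by (simp add: u_def Let_def)
    have "j \<in> {0, 1, 2, 3, 4, 5}"
      using 3(1) by auto
    \<comment> \<open>The real parts occurring in a block are u/2 and u up to sign.\<close>
    then have "?a \<in> strip r" and Re: "\<bar>Re ?a\<bar> \<ge> u / 2"
      using assms u by (auto simp: a strip_def)
    \<comment> \<open>From k = 2 + 6n + j and j < 6, k is at most 6n + 7, hence at most 12(n + 1).
      Such linear growth of the zeros makes the reciprocal squares summable.\<close>
    have "real k / 12 \<le> real (Suc n)"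
      using 3 by simp
    then have "pi / l * (real k / 12) \<le> pi / l * real (Suc n)"
      using assms by (intro mult_left_mono) auto
    also have "\<dots> = u / 2"
      by (simp add: u_def)
    also have "\<dots> \<le> norm ?a"
      using Re abs_Re_le_cmod order_trans by blast
    finally show ?thesis
      using \<open>?a \<in> strip r\<close> Re u by auto
  qed
  then show "?a \<in> strip r" "?a \<noteq> 0" "k \<ge> 2 \<Longrightarrow> norm ?a \<ge> pi / l / 12 * real k"
    by auto
qed

lemma genus1_zeros_trig_test:
  assumes "r > 0" "l > 0"
  shows "genus1_zeros \<infinity> (trig_test_zero r l)"
proof -
  let ?a = "trig_test_zero r l"
  define q where "q = pi / l / 12"
  have q: "q > 0"
    using assms by (simp add: q_def)
  have "summable (\<lambda>k. 1 / (norm (?a k))\<^sup>2)"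
  proof (rule summable_comparison_test_ev)
    show "\<forall>\<^sub>F k in sequentially. norm (1 / (norm (?a k))\<^sup>2) \<le> 1 / q\<^sup>2 * inverse (real k ^ 2)"
      using eventually_ge_at_top[of 2]
    proof eventually_elim
      case (elim k)
      have "q * real k \<le> norm (?a k)"
        using trig_test_zero_properties(3)[OF assms elim] by (simp add: q_def)
      moreover have "q * real k > 0"
        using q elim by simp
      ultimately have "1 / (norm (?a k))\<^sup>2 \<le> 1 / (q * real k)\<^sup>2"
        by (intro divide_left_mono power_mono mult_pos_pos zero_less_power) (use q elim trig_test_zero_properties(2)[OF assms] in auto)
      then show ?case
        by (simp add: power_mult_distrib divide_simps)
    qed
    show "summable (\<lambda>k. 1 / q\<^sup>2 * inverse (real k ^ 2))"
      by (intro summable_mult inverse_power_summable) simp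
  qed
  then show ?thesis
    using trig_test_zero_properties(2)[OF assms] summable_on_UNIV_nonneg_real_iff[of "\<lambda>k. 1 / (norm (?a k))\<^sup>2"]
    by (simp add: genus1_zeros_def)
qed

text \<open>The test function equals -2 sin(2 pi u) sin(pi(u+v)) sin(pi(u-v)). Euler's sine product
  is applied to each sine and, for normalisation, to sin(pi v)^2 = (1 - cosh(lr)) / 2. The
  comparison is made between finite partial products, so no infinite product is rearranged.\<close>

lemma trig_test_product:
  assumes "r > 0" "l > 0"
  shows "trig_test r l z = of_real (l * (1 - cosh (l * r))) * z * canonical_product \<infinity> (trig_test_zero r l) z"
proof -
  \<comment> \<open>Rescaling by s = 2 pi / l turns the real parts of the boundary zeros into
    integers: z = su and ir = sv, with v purely imaginary and nonzero, so that no k + v or k - v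
    vanishes.\<close>
  define u where "u = of_real l * z / (2 * of_real pi)"
  define v where "v = \<i> * complex_of_real (l * r / (2 * pi))"
  define A :: "complex \<Rightarrow> nat \<Rightarrow> complex" where "A w n = (\<Prod>k=1..n. 1 - w\<^sup>2 / of_nat k ^ 2)" for w n
  define B where "B n = (\<Prod>k=1..n. (1 - (2 * u)\<^sup>2 / of_nat k ^ 2) * (1 - u\<^sup>2 / (of_nat k - v)\<^sup>2) * (1 - u\<^sup>2 / (of_nat k + v)\<^sup>2))" for n
  have v: "v \<noteq> 0" "of_nat k - v \<noteq> 0" "of_nat k + v \<noteq> 0" if "k \<ge> 1" for k
    using that assms by (auto simp: v_def complex_eq_iff)
  define s :: complex where "s = 2 * of_real pi / of_real l"
  have s: "s \<noteq> 0" and z: "z = s * u" and ir: "\<i> * r = s * v"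
    using assms by (simp_all add: s_def u_def v_def)
  have factor_eq: "(1 - z\<^sup>2 / (s * of_nat k / 2)\<^sup>2) * (1 - z\<^sup>2 / (s * of_nat k - \<i> * r)\<^sup>2) * (1 - z\<^sup>2 / (s * of_nat k + \<i> * r)\<^sup>2)
      = (1 - (2 * u)\<^sup>2 / of_nat k ^ 2) * (1 - u\<^sup>2 / (of_nat k - v)\<^sup>2) * (1 - u\<^sup>2 / (of_nat k + v)\<^sup>2)" for k
    unfolding z ir right_diff_distrib[symmetric] distrib_left[symmetric]
    using s by (simp add: power_mult_distrib power_divide)
  have partial: "(\<Prod>k<2 + 6 * n. (1 - z / trig_test_zero r l k) * exp (z / trig_test_zero r l k))
      = (1 - u\<^sup>2 / v\<^sup>2) * B n" for n
  proof -
    have "(\<Prod>k<2 + 6 * n. (1 - z / trig_test_zero r l k) * exp (z / trig_test_zero r l k))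
      = (1 - z\<^sup>2 / (\<i> * r)\<^sup>2) * (\<Prod>k=1..n. (1 - z\<^sup>2 / (s * of_nat k / 2)\<^sup>2) * (1 - z\<^sup>2 / (s * of_nat k - \<i> * r)\<^sup>2) * (1 - z\<^sup>2 / (s * of_nat k + \<i> * r)\<^sup>2))"
      by (rule trig_test_partial_product) (simp add: s_def)
    also have "1 - z\<^sup>2 / (\<i> * r)\<^sup>2 = 1 - u\<^sup>2 / v\<^sup>2"
      unfolding z ir using s by (simp add: power_mult_distrib)
    finally show ?thesis
      unfolding factor_eq B_def .
  qed
  have finite_index: "enat k < \<infinity> \<longleftrightarrow> True" for k
    by simp
  \<comment> \<open>Convergence is already known, so the limit may be taken along the ends of
    complete blocks.\<close>
  have "strict_mono (\<lambda>n::nat. 2 + 6 * n)"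
    by (simp add: strict_mono_def)
  from LIMSEQ_subseq_LIMSEQ[OF canonical_product_LIMSEQ[OF genus1_zeros_trig_test[OF assms], of z] this]
  have lim: "(\<lambda>n. (1 - u\<^sup>2 / v\<^sup>2) * B n) \<longlonglongrightarrow> canonical_product \<infinity> (trig_test_zero r l) z"
    by (simp only: o_def finite_index if_True partial)
  have sin_lim: "(\<lambda>n. of_real pi * w * A w n) \<longlonglongrightarrow> sin (of_real pi * w)" for w
    unfolding A_def by (rule sin_product_formula_complex)
  \<comment> \<open>The identity at the finite stage: three Euler products on the left, the square
    of the one for v times a partial canonical product on the right. The prefactor (u+v)(u-v)
    supplies the initial zeros ir and -ir.\<close>
  have eq: "(of_real pi * (2 * u) * A (2 * u) n) * (of_real pi * (u + v) * A (u + v) n) * (of_real pi * (u - v) * A (u - v) n)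
      = - (2 * of_real pi * u) * (of_real pi * v * A v n)\<^sup>2 * ((1 - u\<^sup>2 / v\<^sup>2) * B n)" for n
  proof -
    have A_eq: "A (2 * u) n * A (u + v) n * A (u - v) n = (A v n)\<^sup>2 * B n"
      unfolding A_def B_def power2_eq_square[of "prod _ _"] prod.distrib[symmetric]
    proof (rule prod.cong)
      fix k assume "k \<in> {1..n}"
      then have k: "k \<ge> 1" "complex_of_nat k \<noteq> 0" by auto
      \<comment> \<open>Both sides contain the same four linear factors K \<plusminus> u
        \<plusminus> v, paired differently; \<open>ratio\<close> is the regrouping with these
        factors as atoms.\<close>
      have "(1 - (u + v)\<^sup>2 / of_nat k ^ 2) * (1 - (u - v)\<^sup>2 / of_nat k ^ 2)
          = (1 - v\<^sup>2 / of_nat k ^ 2) * (1 - v\<^sup>2 / of_nat k ^ 2) * ((1 - u\<^sup>2 / (of_nat k - v)\<^sup>2) * (1 - u\<^sup>2 / (of_nat k + v)\<^sup>2))"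
      proof -
        define K where "K = complex_of_nat k"
        have K: "K \<noteq> 0" "K - v \<noteq> 0" "K + v \<noteq> 0"
          using k v by (simp_all add: K_def)
        have f1: "1 - v\<^sup>2 / K\<^sup>2 = (K - v) * (K + v) / K\<^sup>2"
          using \<open>K \<noteq> 0\<close> by (simp add: field_simps power2_eq_square)
        have f2: "1 - u\<^sup>2 / (K - v)\<^sup>2 = (K - v - u) * (K - v + u) / (K - v)\<^sup>2"
          using \<open>K - v \<noteq> 0\<close> by (simp add: diff_divide_eq_iff) (simp add: algebra_simps power2_eq_square)
        have f3: "1 - u\<^sup>2 / (K + v)\<^sup>2 = (K + v - u) * (K + v + u) / (K + v)\<^sup>2"
          using \<open>K + v \<noteq> 0\<close> by (simp add: diff_divide_eq_iff) (simp add: algebra_simps power2_eq_square)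
        have f4: "1 - (u + v)\<^sup>2 / K\<^sup>2 = (K - v - u) * (K + v + u) / K\<^sup>2"
          using \<open>K \<noteq> 0\<close> by (simp add: field_simps power2_eq_square)
        have f5: "1 - (u - v)\<^sup>2 / K\<^sup>2 = (K - v + u) * (K + v - u) / K\<^sup>2"
          using \<open>K \<noteq> 0\<close> by (simp add: field_simps power2_eq_square)
        have ratio: "a * b / d\<^sup>2 * (c * e / d\<^sup>2) = p * q / d\<^sup>2 * (p * q / d\<^sup>2) * (a * c / p\<^sup>2 * (e * b / q\<^sup>2))"
          if "p \<noteq> 0" "q \<noteq> 0" for a b c d e p q :: complex
          using that by (simp add: power2_eq_square mult_ac)
        show ?thesis
          unfolding K_def[symmetric] f1 f2 f3 f4 f5 by (rule ratio[OF K(2,3)])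
      qed
      from arg_cong[OF this, of "(*) (1 - (2 * u)\<^sup>2 / of_nat k ^ 2)"]
      show "(1 - (2 * u)\<^sup>2 / of_nat k ^ 2) * (1 - (u + v)\<^sup>2 / of_nat k ^ 2) * (1 - (u - v)\<^sup>2 / of_nat k ^ 2)
          = (1 - v\<^sup>2 / of_nat k ^ 2) * (1 - v\<^sup>2 / of_nat k ^ 2) *
            ((1 - (2 * u)\<^sup>2 / of_nat k ^ 2) * (1 - u\<^sup>2 / (of_nat k - v)\<^sup>2) * (1 - u\<^sup>2 / (of_nat k + v)\<^sup>2))"
        by (simp only: mult_ac)
    qed simp
    have uv: "(u + v) * (u - v) = - (v\<^sup>2 * (1 - u\<^sup>2 / v\<^sup>2))"
      using v(1)[of 1] by (simp add: field_simps power2_eq_square)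
    have "(of_real pi * (2 * u) * A (2 * u) n) * (of_real pi * (u + v) * A (u + v) n) * (of_real pi * (u - v) * A (u - v) n)
        = (2 * of_real pi * u) * (of_real pi)\<^sup>2 * ((u + v) * (u - v)) * (A (2 * u) n * A (u + v) n * A (u - v) n)"
      by (simp only: power2_eq_square mult_ac)
    also have "\<dots> = - (2 * of_real pi * u) * (of_real pi * v * A v n)\<^sup>2 * ((1 - u\<^sup>2 / v\<^sup>2) * B n)"
      unfolding A_eq uv by (simp only: power_mult_distrib mult_minus_left mult_minus_right mult_ac)
    finally show ?thesis .
  qed
  have "sin (of_real pi * (2 * u)) * sin (of_real pi * (u + v)) * sin (of_real pi * (u - v))
      = - (2 * of_real pi * u) * (sin (of_real pi * v))\<^sup>2 * canonical_product \<infinity> (trig_test_zero r l) z"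
  proof (rule LIMSEQ_unique)
    show "(\<lambda>n. - (2 * of_real pi * u) * (of_real pi * v * A v n)\<^sup>2 * ((1 - u\<^sup>2 / v\<^sup>2) * B n))
        \<longlonglongrightarrow> sin (of_real pi * (2 * u)) * sin (of_real pi * (u + v)) * sin (of_real pi * (u - v))"
      unfolding eq[symmetric] by (intro tendsto_mult sin_lim)
    show "(\<lambda>n. - (2 * of_real pi * u) * (of_real pi * v * A v n)\<^sup>2 * ((1 - u\<^sup>2 / v\<^sup>2) * B n))
        \<longlonglongrightarrow> - (2 * of_real pi * u) * (sin (of_real pi * v))\<^sup>2 * canonical_product \<infinity> (trig_test_zero r l) z"
      by (intro tendsto_mult tendsto_power tendsto_const sin_lim lim)
  qed
  moreover have "of_real pi * (2 * u) = of_real l * z" "2 * of_real pi * u = of_real l * z"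
    by (simp_all add: u_def)
  moreover have "cos (of_real l * z) - of_real (cosh (l * r))
      = - 2 * (sin (of_real pi * (u + v)) * sin (of_real pi * (u - v)))"
  proof -
    have "(of_real l * z + \<i> * of_real (l * r)) / 2 = of_real pi * (u + v)"
         "(\<i> * of_real (l * r) - of_real l * z) / 2 = - (of_real pi * (u - v))"
      by (simp_all add: u_def v_def field_simps)
    then show ?thesis
      unfolding cosh_complex_of_real[symmetric] cosh_conv_cos cos_diff_cos by simp
  qed
  moreover have "1 - of_real (cosh (l * r)) = 2 * (sin (of_real pi * v))\<^sup>2"
  proof -
    have "2 * (of_real pi * v) = \<i> * of_real (l * r)"
      by (simp add: v_def)
    then show ?thesis
      unfolding cosh_complex_of_real[symmetric] cosh_conv_cos using cos_double_sin[of "of_real pi * v"] by simp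
  qed
  moreover have "complex_of_real (l * (1 - cosh (l * r))) = of_real l * (1 - of_real (cosh (l * r)))"
    by simp
  ultimately show ?thesis
    unfolding trig_test_def by (simp add: mult_ac)
qed

lemma trig_test_in_LP:
  assumes "r > 0" "l > 0"
  shows "trig_test r l \<in> LP r"
proof -
  have "trig_test r l holomorphic_on UNIV"
    unfolding trig_test_def[abs_def] by (intro holomorphic_intros)
  moreover have "trig_test r l (of_real x) \<in> \<real>" for x
    by (simp add: trig_test_def flip: of_real_mult sin_of_real cos_of_real of_real_diff)
  moreover have "LP_rep r 0 (trig_test r l)"
    unfolding LP_rep_def
    using genus1_zeros_trig_test[OF assms] trig_test_zero_properties(1)[OF assms] trig_test_product[OF assms]
    by (intro exI[of _ "l * (1 - cosh (l * r))"] exI[of _ 0] exI[of _ 1] exI[of _ \<infinity>] exI[of _ "trig_test_zero r l"]) simp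
  ultimately show ?thesis
    by (auto simp: LP_def real_entire_def)
qed

section \<open>The image of the test function and the growth inequality\<close>

text \<open>Multiplication by x^2 clears the negative frequencies: frequency jl lands on the power j
  + 2, and the absent frequency 0 is the middle coefficient 0.\<close>

lemma diff_op_trig_test:
  fixes \<phi> :: "complex \<Rightarrow> complex" and l r :: real and z :: complex
  assumes "\<phi> holomorphic_on UNIV"
  defines "x \<equiv> exp (\<i> * l * z)"
  shows "x\<^sup>2 * diff_op \<phi> (trig_test r l) z =
    poly [:- \<phi> (- (\<i> * (2 * l))) / (4 * \<i>), complex_of_real (cosh (l * r)) * \<phi> (- (\<i> * l)) / (2 * \<i>), 0,
           - complex_of_real (cosh (l * r)) * \<phi> (\<i> * l) / (2 * \<i>), \<phi> (\<i> * (2 * l)) / (4 * \<i>):] x"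
proof -
  define C where "C = complex_of_real (cosh (l * r))"
  \<comment> \<open>The coefficients come from sin cos = sin(2lz)/2 and from -C sin(lz), written in
    exponentials.\<close>
  define c where "c j = (if j = 2 then 1 / (4 * \<i>) else if j = -2 then - 1 / (4 * \<i>)
      else if j = 1 then - C / (2 * \<i>) else C / (2 * \<i>))" for j :: int
  define \<mu> where "\<mu> j = \<i> * (of_int j * of_real l)" for j :: int
  have exp_\<mu>: "exp (\<mu> 2 * w) = exp (\<i> * l * w) ^ 2" "exp (\<mu> (-2) * w) = inverse (exp (\<i> * l * w)) ^ 2"
      "exp (\<mu> 1 * w) = exp (\<i> * l * w)" "exp (\<mu> (-1) * w) = inverse (exp (\<i> * l * w))" for w
    by (simp_all add: \<mu>_def mult_ac flip: exp_of_nat_mult exp_minus)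
  have "trig_test r l = (\<lambda>w. \<Sum>j\<in>{2, -2, 1, -1}. c j * exp (\<mu> j * w))"
  proof
    fix w
    define e where "e = exp (\<i> * l * w)"
    have "e \<noteq> 0"
      by (simp add: e_def)
    have "sin (l * w) = (e - inverse e) / (2 * \<i>)" "cos (l * w) = (e + inverse e) / 2"
      unfolding sin_exp_eq cos_exp_eq e_def by (simp_all add: mult_ac flip: exp_minus)
    then have "trig_test r l w = (e - inverse e) / (2 * \<i>) * ((e + inverse e) / 2 - C)"
      by (simp add: trig_test_def C_def)
    also have "\<dots> = (e\<^sup>2 - inverse e ^ 2) / (4 * \<i>) - C * (e - inverse e) / (2 * \<i>)"
      by (simp add: field_simps power2_eq_square)
    also have "\<dots> = (\<Sum>j\<in>{2, -2, 1, -1}. c j * exp (\<mu> j * w))"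
      by (simp add: exp_\<mu> c_def flip: e_def) (simp add: field_simps)
    finally show "trig_test r l w = (\<Sum>j\<in>{2, -2, 1, -1}. c j * exp (\<mu> j * w))" .
  qed
  then have "diff_op \<phi> (trig_test r l) z = (\<Sum>j\<in>{2, -2, 1, -1}. c j * \<phi> (\<mu> j) * exp (\<mu> j * z))"
    by (simp only: diff_op_exp_sum[OF assms(1)])
  also have "\<dots> = 1 / (4 * \<i>) * \<phi> (\<i> * (2 * l)) * x\<^sup>2 + - 1 / (4 * \<i>) * \<phi> (- (\<i> * (2 * l))) * inverse x ^ 2
      + - C / (2 * \<i>) * \<phi> (\<i> * l) * x + C / (2 * \<i>) * \<phi> (- (\<i> * l)) * inverse x"
    by (simp add: exp_\<mu> c_def flip: x_def) (simp add: \<mu>_def)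
  finally have eq: "diff_op \<phi> (trig_test r l) z = \<dots>" .
  have "x \<noteq> 0"
    by (simp add: x_def)
  then show ?thesis
    unfolding eq C_def by (simp add: field_simps power2_eq_square)
qed

lemma trig_test_image_in_LP_imp:
  fixes \<phi> :: "complex \<Rightarrow> complex" and l r r1 :: real
  assumes hol: "\<phi> holomorphic_on UNIV" and "r1 \<ge> 0" "l > 0"
    and LP: "diff_op \<phi> (trig_test r l) \<in> LP r1"
    and nz: "\<phi> (\<i> * (2 * l)) \<noteq> 0" "\<phi> (- (\<i> * (2 * l))) \<noteq> 0"
  shows "cosh (l * r) * norm (\<phi> (\<i> * l)) \<le> 2 * exp (l * r1) * norm (\<phi> (\<i> * (2 * l)))"
proof -
  define p where "p = [:- \<phi> (- (\<i> * (2 * l))) / (4 * \<i>), complex_of_real (cosh (l * r)) * \<phi> (- (\<i> * l)) / (2 * \<i>), 0,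
           - complex_of_real (cosh (l * r)) * \<phi> (\<i> * l) / (2 * \<i>), \<phi> (\<i> * (2 * l)) / (4 * \<i>):]"
  note poly_eq = diff_op_trig_test[OF hol, of l _ r, folded p_def]
  have deg: "degree p = 4"
    using nz by (simp add: p_def)
  have surj: "\<exists>z. x = exp (\<i> * l * z)" if "x \<noteq> 0" for x
    using that \<open>l > 0\<close> by (intro exI[of _ "Ln x / (\<i> * l)"]) simp
  \<comment> \<open>The zero function belongs to \<open>LP r1\<close>, so it has to be excluded
    before zeros can be located: it would give a polynomial of degree 4 vanishing at every nonzero
    x.\<close>
  have "\<exists>w. diff_op \<phi> (trig_test r l) w \<noteq> 0"
  proof (rule ccontr)
    assume "\<nexists>w. diff_op \<phi> (trig_test r l) w \<noteq> 0"
    then have "poly p x = 0" if "x \<noteq> 0" for x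
      using surj[OF that] poly_eq by auto
    then have "- {0} \<subseteq> {x. poly p x = 0}"
      by auto
    moreover have "finite {x. poly p x = 0}"
      using deg by (intro poly_roots_finite) auto
    moreover have "infinite (- {0 :: complex})"
      by (simp add: infinite_UNIV_char_0 Compl_eq_Diff_UNIV)
    ultimately show False
      using finite_subset by blast
  qed
  then obtain w where w: "diff_op \<phi> (trig_test r l) w \<noteq> 0" ..
  have root: "norm x \<le> exp (l * r1)" if "poly p x = 0" for x
  proof -
    \<comment> \<open>The constant term is a nonzero multiple of the value of \<open>\<phi>\<close>
      at -2il.\<close>
    have "x \<noteq> 0"
      using that nz by (auto simp: p_def)
    then obtain z where z: "x = exp (\<i> * l * z)"
      using surj by blast
    then have "diff_op \<phi> (trig_test r l) z = 0"
      using that poly_eq[of z] by auto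
    then have "z \<in> strip r1"
      by (rule LP_zero_in_strip[OF LP \<open>r1 \<ge> 0\<close> _ w])
    then have "l * (- Im z) \<le> l * r1"
      using \<open>l > 0\<close> by (intro mult_left_mono) (auto simp: strip_def)
    then show ?thesis
      by (simp add: z)
  qed
  \<comment> \<open>The moduli of these coefficients are cosh(lr) |\<phi>(il)| / 2 and |\<phi>(2il)|
    / 4, whence the constant 2.\<close>
  have "norm (coeff p 3) \<le> 4 * exp (l * r1) * norm (coeff p 4)"
    using poly_subleading_coeff_bound[of p "exp (l * r1)"] deg root by simp
  then show ?thesis
    by (simp add: p_def norm_mult norm_divide eval_nat_numeral)
qed

text \<open>The strip of half-width 1 suffices. What matters is that r1 is the same for all f, so
  the frequency y can grow while r1 stays fixed.\<close>

lemma CZSDO_imp_exponential_growth: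
  assumes "\<phi> \<in> LP1 0" "\<phi> \<noteq> (\<lambda>_. 0)" "CZSDO \<phi>"
  obtains K \<delta> where "K > 0" "\<delta> > 0"
    "\<And>y. 1 \<le> y \<Longrightarrow> K * exp (\<delta> * y) \<le> norm (\<phi> (\<i> * complex_of_real (2 * y)))"
proof -
  have hol: "\<phi> holomorphic_on UNIV"
    using assms(1) by (simp add: LP1_def real_entire_def)
  obtain C where C: "C > 0" "\<And>y. 1 \<le> \<bar>y\<bar> \<Longrightarrow> C \<le> norm (\<phi> (\<i> * complex_of_real y))"
    using LP1_imaginary_lower_bound[OF assms(1,2)] by blast
  have "\<exists>r1. 0 \<le> r1 \<and> r1 < 1 \<and> (\<forall>f \<in> LP 1. diff_op \<phi> f \<in> LP r1)"
    using assms(3) unfolding CZSDO_def by (rule allE[of _ 1]) simp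
  then obtain r1 where r1: "0 \<le> r1" "r1 < 1" "\<And>f. f \<in> LP 1 \<Longrightarrow> diff_op \<phi> f \<in> LP r1"
    by blast
  show thesis
  \<comment> \<open>cosh y is at least exp(y)/2, which together with the factor 2 of the growth
    inequality gives C/4; dividing exp(y) by exp(y r1) leaves the rate 1 - r1.\<close>
  proof (rule that[of "C / 4" "1 - r1"])
    fix y :: real
    assume y: "1 \<le> y"
    have "\<phi> (\<i> * complex_of_real (2 * y)) \<noteq> 0" "\<phi> (\<i> * complex_of_real (- (2 * y))) \<noteq> 0"
      using C(1) C(2)[of "2 * y"] C(2)[of "- (2 * y)"] y by auto
    then have "cosh y * norm (\<phi> (\<i> * y)) \<le> 2 * exp (y * r1) * norm (\<phi> (\<i> * complex_of_real (2 * y)))"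
      using trig_test_image_in_LP_imp[OF hol r1(1), of y 1] y r1(3) trig_test_in_LP[of 1 y] by simp
    moreover have "exp y / 2 * C \<le> cosh y * norm (\<phi> (\<i> * y))"
      using C y by (intro mult_mono) (auto simp: cosh_field_def)
    ultimately have "exp y * C / 4 \<le> exp (y * r1) * norm (\<phi> (\<i> * complex_of_real (2 * y)))"
      by simp
    moreover have "exp y = exp (y * r1) * exp ((1 - r1) * y)"
      by (simp add: algebra_simps flip: exp_add)
    ultimately have "exp (y * r1) * (C / 4 * exp ((1 - r1) * y)) \<le> exp (y * r1) * norm (\<phi> (\<i> * complex_of_real (2 * y)))"
      by (simp add: mult_ac)
    then show "C / 4 * exp ((1 - r1) * y) \<le> norm (\<phi> (\<i> * complex_of_real (2 * y)))"
      by (simp only: mult_le_cancel_left_pos exp_gt_zero)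
  qed (use C r1 in auto)
qed

section \<open>From growth on the imaginary axis to order and type\<close>

lemma norm_le_max_modulus:
  assumes "continuous_on UNIV f"
  shows "norm (f z) \<le> max_modulus f (norm z)"
  unfolding max_modulus_def
proof (rule cSUP_upper)
  have "compact ((\<lambda>z. norm (f z)) ` sphere 0 (norm z))"
    using assms continuous_on_subset
    by (intro compact_continuous_image continuous_on_norm compact_sphere) auto
  then show "bdd_above ((\<lambda>z. norm (f z)) ` sphere 0 (norm z))"
    by (intro bounded_imp_bdd_above compact_imp_bounded)
qed simp

lemma exponential_growth_imp_order_type:
  assumes "continuous_on UNIV f" "K > 0" "\<delta> > 0"
    and growth: "\<And>y. 1 \<le> y \<Longrightarrow> K * exp (\<delta> * y) \<le> norm (f (\<i> * complex_of_real (2 * y)))"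
  shows "growth_order f = 1 \<and> growth_type f > 0 \<or> growth_order f > 1"
proof -
  \<comment> \<open>The lower bound with exponent \<open>\<delta> * y\<close> is attained at modulus
    2y, so in terms of r the rate is \<open>\<delta> / 2\<close>. Both order and type reduce to this
    claim.\<close>
  have rate: "\<epsilon> \<ge> \<delta> / 2" if ev: "\<forall>\<^sub>F r in at_top. max_modulus f r < exp (\<epsilon> * r)" for \<epsilon>
  proof (rule ccontr)
    assume "\<not> \<epsilon> \<ge> \<delta> / 2"
    then have \<epsilon>: "\<delta> - 2 * \<epsilon> > 0"
      by simp
    have "\<forall>\<^sub>F y in at_top. max_modulus f (2 * y) < exp (\<epsilon> * (2 * y))"
      by (rule eventually_compose_filterlim[OF ev]) real_asymp
    moreover have "\<forall>\<^sub>F y in at_top. K * exp ((\<delta> - 2 * \<epsilon>) * y) > 1"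
      using \<epsilon> \<open>K > 0\<close> by real_asymp
    ultimately have "\<forall>\<^sub>F y::real in at_top. False"
      using eventually_ge_at_top[of 1]
    proof eventually_elim
      case (elim y)
      have "K * exp (\<delta> * y) \<le> max_modulus f (2 * y)"
        using growth[of y] norm_le_max_modulus[OF assms(1), of "\<i> * complex_of_real (2 * y)"] elim
        by (simp add: norm_mult)
      also have "\<dots> < exp (\<epsilon> * (2 * y))"
        by (rule elim)
      also have "\<dots> \<le> exp (\<epsilon> * (2 * y)) * (K * exp ((\<delta> - 2 * \<epsilon>) * y))"
        using elim by simp
      also have "\<dots> = K * exp (\<delta> * y)"
        by (simp add: algebra_simps flip: exp_add)
      finally show False by simp
    qed
    then show False by simp
  qed
  have "growth_order f \<ge> 1"
    unfolding growth_order_def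
  proof (rule Inf_greatest, safe)
    fix k :: real
    assume ev: "\<forall>\<^sub>F r in at_top. max_modulus f r < exp (r powr k)"
    have "k \<ge> 1"
    proof (rule ccontr)
      assume "\<not> k \<ge> 1"
      \<comment> \<open>An order below 1 would allow every positive rate;
        \<open>\<delta> / 4\<close> already contradicts \<open>rate\<close>.\<close>
      then have "\<forall>\<^sub>F r in at_top. r powr k < \<delta> / 4 * r"
        using \<open>\<delta> > 0\<close> by real_asymp
      with ev have "\<forall>\<^sub>F r in at_top. max_modulus f r < exp (\<delta> / 4 * r)"
        by eventually_elim (meson exp_less_mono less_trans)
      from rate[OF this] show False
        using \<open>\<delta> > 0\<close> by simp
    qed
    then show "1 \<le> ereal k" by simp
  qed
  moreover have "growth_type f > 0" if "growth_order f = 1"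
  proof -
    have "growth_type f \<ge> ereal (\<delta> / 2)"
      unfolding growth_type_def
    proof (rule Inf_greatest, safe)
      fix \<epsilon> :: real
      assume "\<forall>\<^sub>F r in at_top. max_modulus f r < exp (\<epsilon> * r powr real_of_ereal (growth_order f))"
      then have "\<forall>\<^sub>F r in at_top. max_modulus f r < exp (\<epsilon> * r)"
        using eventually_gt_at_top[of 0] by eventually_elim (simp add: that)
      from rate[OF this] show "ereal (\<delta> / 2) \<le> ereal \<epsilon>" by simp
    qed
    moreover have "ereal (\<delta> / 2) > 0"
      using \<open>\<delta> > 0\<close> by simp
    ultimately show ?thesis
      by (rule less_le_trans[rotated])
  qed
  ultimately show ?thesis
    by (auto simp: less_le)
qed

text \<open>Part (b) does not assume that the symbol is nonzero; this shows that order 1 forces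
  it.\<close>

lemma growth_order_zero_less_1: "growth_order (\<lambda>_. 0) < 1"
proof -
  have "\<forall>\<^sub>F r::real in at_top. max_modulus (\<lambda>_. 0) r < exp (r powr (1 / 2))"
    using eventually_ge_at_top[of 0] by eventually_elim (simp add: max_modulus_def)
  then have "growth_order (\<lambda>_. 0) \<le> ereal (1 / 2)"
    unfolding growth_order_def by (intro Inf_lower) (auto intro!: exI[of _ "1 / 2"])
  also have "\<dots> < 1" by simp
  finally show ?thesis .
qed

section \<open>Exponential symbols and the theorem\<close>

lemma exp_in_LP1: "(\<lambda>w. exp (of_real \<alpha> * w)) \<in> LP1 0"
proof -
  have "(\<lambda>w. exp (complex_of_real \<alpha> * w)) holomorphic_on UNIV"
    by (intro holomorphic_intros)
  moreover have "exp (complex_of_real \<alpha> * of_real x) \<in> \<real>" for x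
    by (simp flip: of_real_mult exp_of_real)
  moreover have "LP_rep 0 0 (\<lambda>w. exp (complex_of_real \<alpha> * w))"
    unfolding LP_rep_def
    by (intro exI[of _ 1] exI[of _ \<alpha>] exI[of _ 0] exI[of _ 0] exI[of _ "\<lambda>_. 1"])
      (simp add: genus1_zeros_def canonical_product_def flip: zero_enat_def)
  ultimately show ?thesis
    by (simp add: LP1_def real_entire_def)
qed

text \<open>On the imaginary axis the symbol has modulus 1, which is incompatible with exponential
  growth there.\<close>

lemma exp_not_CZSDO: "\<not> CZSDO (\<lambda>w. exp (of_real \<alpha> * w))"
proof
  assume CZSDO: "CZSDO (\<lambda>w. exp (of_real \<alpha> * w))"
  have "(\<lambda>w. exp (complex_of_real \<alpha> * w)) \<noteq> (\<lambda>_. 0)"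
    by (simp add: fun_eq_iff)
  from CZSDO_imp_exponential_growth[OF exp_in_LP1 this CZSDO]
  obtain K \<delta> where K: "K > 0" "\<delta> > 0"
    "\<And>y. 1 \<le> y \<Longrightarrow> K * exp (\<delta> * y) \<le> norm (exp (of_real \<alpha> * (\<i> * complex_of_real (2 * y))))"
    by blast
  have "\<forall>\<^sub>F y in at_top. K * exp (\<delta> * y) > 1"
    using K(1,2) by real_asymp
  then have "\<forall>\<^sub>F y::real in at_top. False"
    using eventually_ge_at_top[of 1] by eventually_elim (use K(3) in fastforce)
  then show False by simp
qed

theorem theorem1p6:
  shows
   "(\<forall>\<phi> \<in> LP1 0. \<phi> \<noteq> (\<lambda>_. 0) \<and> growth_order \<phi> < 1 \<longrightarrow> \<not> CZSDO \<phi>)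
  \<and> (\<forall>\<phi> \<in> LP1 0. growth_order \<phi> = 1 \<and> growth_type \<phi> = 0 \<longrightarrow> \<not> CZSDO \<phi>)
  \<and> (\<forall>\<alpha>::real.
        (\<forall>r\<ge>0. \<forall>f \<in> LP r. \<forall>z.
            diff_op (\<lambda>w. exp (of_real \<alpha> * w)) f z = f (z + of_real \<alpha>))
        \<and> \<not> CZSDO (\<lambda>w. exp (of_real \<alpha> * w)))
  \<and> (\<forall>\<phi> \<in> LP1 0. \<phi> \<noteq> (\<lambda>_. 0) \<and> CZSDO \<phi> \<longrightarrow>
        (\<forall>(c::real) (m::nat) (\<alpha>::real) (N::enat) (a :: nat \<Rightarrow> real).
            c \<noteq> 0 \<and> genus1_zeros N (\<lambda>n. of_real (a n))
            \<and> (\<forall>z. \<phi> z = of_real c * z ^ m * exp (of_real \<alpha> * z)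
                          * canonical_product N (\<lambda>n. of_real (a n)) z)
            \<longrightarrow> (let \<psi> = (\<lambda>z. of_real c * z ^ m * canonical_product N (\<lambda>n. of_real (a n)) z)
                 in (growth_order \<psi> = 1 \<and> growth_type \<psi> > 0) \<or> growth_order \<psi> > 1)))"
proof -
  \<comment> \<open>Since \<alpha> is real, \<open>\<phi>\<close> and \<open>\<psi>\<close> have
    equal modulus on the imaginary axis, so the growth passes to \<open>\<psi>\<close>. The case
    \<alpha> = 0 yields (a) and (b) by contraposition.\<close>
  have necessary: "growth_order \<psi> = 1 \<and> growth_type \<psi> > 0 \<or> growth_order \<psi> > 1"
    if "\<phi> \<in> LP1 0" "\<phi> \<noteq> (\<lambda>_. 0)" "CZSDO \<phi>" and \<psi>: "\<And>z. \<phi> z = exp (of_real \<alpha> * z) * \<psi> z"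
    for \<phi> \<psi> and \<alpha> :: real
  proof -
    obtain K \<delta> where K: "K > 0" "\<delta> > 0"
      "\<And>y. 1 \<le> y \<Longrightarrow> K * exp (\<delta> * y) \<le> norm (\<phi> (\<i> * complex_of_real (2 * y)))"
      using CZSDO_imp_exponential_growth[OF \<open>\<phi> \<in> LP1 0\<close> \<open>\<phi> \<noteq> (\<lambda>_. 0)\<close> \<open>CZSDO \<phi>\<close>] by blast
    \<comment> \<open>Solving for \<open>\<psi>\<close> gives its continuity from that of
      \<open>\<phi>\<close>, without studying the infinite product as a function of z.\<close>
    have "\<psi> = (\<lambda>z. exp (- (of_real \<alpha> * z)) * \<phi> z)"
      by (simp add: \<psi> fun_eq_iff flip: exp_add mult.assoc)
    moreover have "\<phi> holomorphic_on UNIV"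
      using that(1) by (simp add: LP1_def real_entire_def)
    ultimately have "continuous_on UNIV \<psi>"
      by (simp only:) (intro holomorphic_on_imp_continuous_on holomorphic_intros)
    from exponential_growth_imp_order_type[OF this K(1,2)] show ?thesis
      using K(3) by (simp add: \<psi> norm_mult)
  qed
  have order_type: "growth_order \<phi> = 1 \<and> growth_type \<phi> > 0 \<or> growth_order \<phi> > 1"
    if "\<phi> \<in> LP1 0" "\<phi> \<noteq> (\<lambda>_. 0)" "CZSDO \<phi>" for \<phi>
    by (rule necessary[OF that, of 0]) simp
  show ?thesis
  proof (intro conjI ballI allI impI)
    fix \<phi> assume "\<phi> \<in> LP1 0" "\<phi> \<noteq> (\<lambda>_. 0) \<and> growth_order \<phi> < 1"
    then show "\<not> CZSDO \<phi>"
      using order_type[of \<phi>] by (metis less_irrefl less_trans)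
  next
    fix \<phi> assume "\<phi> \<in> LP1 0" and *: "growth_order \<phi> = 1 \<and> growth_type \<phi> = 0"
    moreover have "\<phi> \<noteq> (\<lambda>_. 0)"
      using growth_order_zero_less_1 * by auto
    ultimately show "\<not> CZSDO \<phi>"
      using order_type[of \<phi>] by auto
  next
    fix \<alpha> r :: real and f z assume "f \<in> LP r"
    then have "f holomorphic_on UNIV"
      by (simp add: LP_def real_entire_def)
    then show "diff_op (\<lambda>w. exp (of_real \<alpha> * w)) f z = f (z + of_real \<alpha>)"
      by (rule diff_op_exp)
  next
    fix \<alpha> :: real
    show "\<not> CZSDO (\<lambda>w. exp (of_real \<alpha> * w))"
      by (rule exp_not_CZSDO)
  next
    fix \<phi> and c \<alpha> :: real and m :: nat and N and a :: "nat \<Rightarrow> real"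
    assume "\<phi> \<in> LP1 0" "\<phi> \<noteq> (\<lambda>_. 0) \<and> CZSDO \<phi>"
      and rep: "c \<noteq> 0 \<and> genus1_zeros N (\<lambda>n. of_real (a n))
            \<and> (\<forall>z. \<phi> z = of_real c * z ^ m * exp (of_real \<alpha> * z)
                          * canonical_product N (\<lambda>n. of_real (a n)) z)"
    then show "let \<psi> = (\<lambda>z. of_real c * z ^ m * canonical_product N (\<lambda>n. of_real (a n)) z)
                 in (growth_order \<psi> = 1 \<and> growth_type \<psi> > 0) \<or> growth_order \<psi> > 1"
      unfolding Let_def by (intro necessary[of \<phi> \<alpha>]) (auto simp: mult_ac)
  qed
qed

end
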